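(* Let $R$ be a local ring with maximal ideal $\mathfrak{m}$ and residue field $k=R/\mathfrak{m}$. Let $n$ be a positive integer and let $m$ be the $\mathrm{char}(k)$-free part of $n$. Assume that either $\mathrm{char}(k)\nmid n$, or $\mathrm{char}(R)=\mathrm{char}(k)$ and $R$ is reduced. Then the following statements are true. (a) $s_n(R)\geq s_m(k)$ and $w_n(R)\geq w_m(k)$. (b) If $R$ is henselian and $s_m(k)<\infty$, then $s_n(R)=s_m(k)$ and $w_n(R)\leq\max\{w_m(k),\,s_m(k)+1\}$. (c) If $\mathfrak{m}\neq\mathfrak{m}^2$, $f\in\mathfrak{m}\setminus\mathfrak{m}^2$ and $m>1$, then $\ell_n(f)\geq s_m(k)+1$. In particular (when $\mathfrak{m}\neq\mathfrak{m}^2$ and $m>1$), $w_n(R)\geq s_m(k)+1$.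
   Context: All rings are commutative with $1$. For a ring $A$ and a positive integer $n$: for $a\in A$, the $n$-length $\ell_n(a)$ is the smallest positive integer $g$ such that $a$ is a sum of $g$ $n$th powers of elements of $A$ ($\infty$ if no such $g$ exists); $s_n(A)=\ell_n(-1)$ is the $n$th level of $A$; the $n$th Waring number $w_n(A)$ is the smallest positive integer $g$ such that every element of $A$ that is a sum of (finitely many) $n$th powers is a sum of at most $g$ $n$th powers ($\infty$ if no such $g$ exists). For a prime $p$ and $n=p^{j}m$ with $p\nmid m$, $j\ge 0$, the $p$-free part of $n$ is $m$; the $0$-free part of $n$ is $n$ itself. (When $\mathrm{char}(k)=0$, the condition $\mathrm{char}(k)\nmid n$ holds for every positive $n$.) A local ring $R$ with maximal ideal $\mathfrak{m}$ is henselian if for every $f\in R[x]$ and $b\in R$ with $f(b)\in\mathfrak{m}$, $f'(b)\notin\mathfrak{m}$ there is $a\in R$ with $f(a)=0$ and $a\equiv b \pmod{\mathfrak{m}}$. A ring is reduced if it has no nonzero nilpotents.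
   Formalization: In the last claim of (c), w_n(R) ≥ s_m(k)+1 is stated only for s_m(k) < ∞; as printed it fails for R = ℝ[[t]], n = 2, where s_2(ℝ) = ∞ but w_2(R) = 1. *)

theory Defs
  imports
    "HOL-Algebra.QuotRing"
    "HOL-Algebra.Ideal_Product"
    "HOL-Algebra.UnivPoly"
    "HOL-Computational_Algebra.Primes"
    "HOL-Library.Extended_Nat"
begin

definition sum_of_powers :: "('a, 'b) ring_scheme \<Rightarrow> nat \<Rightarrow> nat \<Rightarrow> 'a \<Rightarrow> bool" where
  "sum_of_powers A n g a \<longleftrightarrow>
     (\<exists>x \<in> {..<g} \<rightarrow> carrier A. a = (\<Oplus>\<^bsub>A\<^esub>i\<in>{..<g}. x i [^]\<^bsub>A\<^esub> n))"

(* In enat the infimum of the empty set is \<infinity>. *)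
definition nlength :: "('a, 'b) ring_scheme \<Rightarrow> nat \<Rightarrow> 'a \<Rightarrow> enat" where
  "nlength A n a = Inf {enat g | g. 0 < g \<and> sum_of_powers A n g a}"

definition nlevel :: "('a, 'b) ring_scheme \<Rightarrow> nat \<Rightarrow> enat" where
  "nlevel A n = nlength A n (\<ominus>\<^bsub>A\<^esub> \<one>\<^bsub>A\<^esub>)"

definition waring :: "('a, 'b) ring_scheme \<Rightarrow> nat \<Rightarrow> enat" where
  "waring A n = Inf {enat g | g. 0 < g \<and>
     (\<forall>a \<in> carrier A. (\<exists>h>0. sum_of_powers A n h a) \<longrightarrow>
        (\<exists>h>0. h \<le> g \<and> sum_of_powers A n h a))}"

definition ring_char :: "('a, 'b) ring_scheme \<Rightarrow> nat" where
  "ring_char A =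
     (if \<exists>c::nat. 0 < c \<and> [c] \<cdot>\<^bsub>A\<^esub> \<one>\<^bsub>A\<^esub> = \<zero>\<^bsub>A\<^esub>
      then LEAST c::nat. 0 < c \<and> [c] \<cdot>\<^bsub>A\<^esub> \<one>\<^bsub>A\<^esub> = \<zero>\<^bsub>A\<^esub>
      else 0)"

(* Meant for p = 0 or p prime, and n > 0. *)
definition free_part :: "nat \<Rightarrow> nat \<Rightarrow> nat" where
  "free_part p n = (if p = 0 then n else n div p ^ multiplicity p n)"

definition reduced_ring :: "('a, 'b) ring_scheme \<Rightarrow> bool" where
  "reduced_ring A \<longleftrightarrow>
     (\<forall>a \<in> carrier A. \<forall>e::nat. a [^]\<^bsub>A\<^esub> e = \<zero>\<^bsub>A\<^esub> \<longrightarrow> a = \<zero>\<^bsub>A\<^esub>)"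

locale local_ring = cring R + maximalideal M R for M and R (structure) +
  assumes maximal_unique: "maximalideal J R \<Longrightarrow> J = M"

definition UP_deriv :: "('a, 'b) ring_scheme \<Rightarrow> (nat \<Rightarrow> 'a) \<Rightarrow> nat \<Rightarrow> 'a" where
  "UP_deriv A f = (\<lambda>i. [Suc i] \<cdot>\<^bsub>A\<^esub> up_ring.coeff (UP A) f (Suc i))"

(* UnivPoly.eval is the extension to polynomials of a ring homomorphism on the
   coefficients, here the identity. It is only specified on carrier (UP A). *)
definition poly_value :: "('a, 'b) ring_scheme \<Rightarrow> (nat \<Rightarrow> 'a) \<Rightarrow> 'a \<Rightarrow> 'a" where
  "poly_value A f b = UnivPoly.eval A A (\<lambda>c. c) b f"

lemma (in cring) UP_deriv_closed:
  assumes "f \<in> carrier (UP R)"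
  shows "UP_deriv R f \<in> carrier (UP R)"
proof -
  have f: "f \<in> up R" using assms by (simp add: UP_def)
  then obtain n where n: "bound \<zero> n f" by (auto simp: up_def)
  have "bound \<zero> n (\<lambda>i. [Suc i] \<cdot> f (Suc i))"
  proof
    fix i assume "n < i"
    then have "f (Suc i) = \<zero>" using n by (auto simp: bound_def)
    then show "[Suc i] \<cdot> f (Suc i) = \<zero>" by (simp del: add_pow_def)
  qed
  moreover have "f i \<in> carrier R" for i using f by (auto simp: up_def)
  ultimately show ?thesis using f
    unfolding UP_deriv_def by (auto simp: UP_def up_def)
qed

definition henselian :: "'a set \<Rightarrow> ('a, 'b) ring_scheme \<Rightarrow> bool" where
  "henselian M R \<longleftrightarrow> local_ring M R \<and>
     (\<forall>f \<in> carrier (UP R). \<forall>b \<in> carrier R.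
        poly_value R f b \<in> M \<and> poly_value R (UP_deriv R f) b \<notin> M \<longrightarrow>
        (\<exists>a \<in> carrier R. poly_value R f a = \<zero>\<^bsub>R\<^esub> \<and> a \<ominus>\<^bsub>R\<^esub> b \<in> M))"

end

theory Submission
  imports Defs
begin

text \<open>Write \<open>n = q m\<close>, where \<open>q\<close> is the \<open>p\<close>-part of \<open>n\<close> for \<open>p = char k\<close> (\<open>q = 1\<close> if
\<open>p\<close> does not divide \<open>n\<close>). Then \<open>x \<mapsto> x\<^sup>q\<close> is additive and injective on \<open>R\<close>, so sums of
\<open>n\<close>th powers are exactly the \<open>q\<close>th powers of sums of \<open>m\<close>th powers, with the same number of
summands, and \<open>w\<^sub>n(R) = w\<^sub>m(R)\<close>. For the exponent \<open>m\<close>, which is invertible in \<open>k\<close>, Hensel's lemma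
applied to \<open>X\<^sup>m + c\<close> lifts every representation in \<open>k\<close> with a nonzero summand; an element of
the maximal ideal gets one from \<open>0 = 1\<^sup>m + (-1)\<close>. Conversely, an element outside \<open>M\<^sup>2\<close> that is
a sum of \<open>n\<close>th powers must have a unit summand, and dividing by it in \<open>k\<close> represents \<open>-1\<close>
by the remaining ones.\<close>

section \<open>Sums of n-th powers: recursion on the number of summands, and transport along
  homomorphisms\<close>

lemma (in cring) sum_of_powers_0: "sum_of_powers R n 0 a \<longleftrightarrow> a = \<zero>"
  by (simp add: sum_of_powers_def)

text \<open>This recursion, with the summand of index \<open>g\<close> written first, replaces
  indexed families by induction on \<open>g\<close> in everything that follows.\<close>

lemma (in cring) sum_of_powers_Suc:
  "sum_of_powers R n (Suc g) a \<longleftrightarrow>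
     (\<exists>x \<in> carrier R. \<exists>b. sum_of_powers R n g b \<and> a = x [^] n \<oplus> b)"
proof
  assume "sum_of_powers R n (Suc g) a"
  then obtain x where x: "x \<in> {..<Suc g} \<rightarrow> carrier R"
    and a: "a = (\<Oplus>i\<in>{..<Suc g}. x i [^] n)"
    by (auto simp: sum_of_powers_def)
  have "a = x g [^] n \<oplus> (\<Oplus>i\<in>{..<g}. x i [^] n)"
    unfolding a lessThan_Suc using x by (subst finsum_insert) auto
  moreover have "sum_of_powers R n g (\<Oplus>i\<in>{..<g}. x i [^] n)"
    unfolding sum_of_powers_def using x by (intro bexI[of _ x]) auto
  ultimately show "\<exists>x \<in> carrier R. \<exists>b. sum_of_powers R n g b \<and> a = x [^] n \<oplus> b"
    using x by blast
next
  assume "\<exists>x \<in> carrier R. \<exists>b. sum_of_powers R n g b \<and> a = x [^] n \<oplus> b"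
  then obtain y x where y: "y \<in> carrier R" and x: "x \<in> {..<g} \<rightarrow> carrier R"
    and a: "a = y [^] n \<oplus> (\<Oplus>i\<in>{..<g}. x i [^] n)"
    by (auto simp: sum_of_powers_def)
  have "(\<Oplus>i\<in>{..<Suc g}. (x(g := y)) i [^] n)
      = y [^] n \<oplus> (\<Oplus>i\<in>{..<g}. (x(g := y)) i [^] n)"
    unfolding lessThan_Suc using x y by (subst finsum_insert) (auto simp: Pi_def)
  also have "(\<Oplus>i\<in>{..<g}. (x(g := y)) i [^] n) = (\<Oplus>i\<in>{..<g}. x i [^] n)"
    using x by (intro finsum_cong') auto
  finally show "sum_of_powers R n (Suc g) a"
    unfolding sum_of_powers_def a using x y
    by (intro bexI[of _ "x(g := y)"]) (auto simp: Pi_def less_Suc_eq)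
qed

lemma (in cring) sum_of_powers_closed:
  "sum_of_powers R n g a \<Longrightarrow> a \<in> carrier R"
  by (induction g arbitrary: a) (auto simp: sum_of_powers_0 sum_of_powers_Suc)

lemma (in cring) sum_of_powers_mult:
  assumes "sum_of_powers R n g a" and c: "c \<in> carrier R"
  shows "sum_of_powers R n g (c [^] n \<otimes> a)"
  using assms(1)
proof (induction g arbitrary: a)
  case 0
  then show ?case using c by (simp add: sum_of_powers_0)
next
  case (Suc g)
  then obtain x b where x: "x \<in> carrier R" and b: "sum_of_powers R n g b"
    and a: "a = x [^] n \<oplus> b"
    by (auto simp: sum_of_powers_Suc)
  have "c [^] n \<otimes> a = (c \<otimes> x) [^] n \<oplus> c [^] n \<otimes> b"
    unfolding a using c x sum_of_powers_closed[OF b] by (simp add: r_distr nat_pow_distrib)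
  then show ?case
    unfolding sum_of_powers_Suc using Suc.IH[OF b] c x by blast
qed

lemma (in cring) sum_of_powers_dvd:
  assumes "sum_of_powers R (q * m) g a"
  shows "sum_of_powers R m g a"
  using assms
proof (induction g arbitrary: a)
  case (Suc g)
  then obtain x b where x: "x \<in> carrier R" and b: "sum_of_powers R (q * m) g b"
    and a: "a = (x [^] q) [^] m \<oplus> b"
    by (auto simp: sum_of_powers_Suc nat_pow_pow)
  then show ?case
    unfolding sum_of_powers_Suc using Suc.IH[OF b] x by blast
qed (simp add: sum_of_powers_0)

text \<open>If all bases lay in \<open>N\<close>, the whole sum would lie in \<open>I\<close>. So
  some base avoids \<open>N\<close>, and commutativity moves its power to the front. Used with
  \<open>N\<close> and \<open>I\<close> both zero in the residue field, and with
  \<open>N = M\<close> and \<open>I\<close> the square of \<open>M\<close> in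
  \<open>R\<close>.\<close>

lemma (in cring) sum_of_powers_split:
  assumes "sum_of_powers R n g a"
    and "\<zero> \<in> I" and "\<And>x y. x \<in> I \<Longrightarrow> y \<in> I \<Longrightarrow> x \<oplus> y \<in> I"
    and "\<And>x. x \<in> N \<Longrightarrow> x [^] n \<in> I"
    and "a \<notin> I"
  obtains g' x b where "g = Suc g'" "x \<in> carrier R" "x \<notin> N"
    "sum_of_powers R n g' b" "a = x [^] n \<oplus> b"
proof -
  have "\<exists>g' x b. g = Suc g' \<and> x \<in> carrier R \<and> x \<notin> N \<and>
      sum_of_powers R n g' b \<and> a = x [^] n \<oplus> b"
    using assms(1,5)
  proof (induction g arbitrary: a)
    case 0
    then show ?case using assms(2) by (simp add: sum_of_powers_0)
  next
    case (Suc g)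
    then obtain x b where x: "x \<in> carrier R" and b: "sum_of_powers R n g b"
      and a: "a = x [^] n \<oplus> b"
      by (auto simp: sum_of_powers_Suc)
    show ?case
    proof (cases "x \<in> N")
      case True
      then have "b \<notin> I" using assms(3,4) Suc.prems(2) a by blast
      then obtain g' y c where g: "g = Suc g'" and y: "y \<in> carrier R" "y \<notin> N"
        and c: "sum_of_powers R n g' c" and b': "b = y [^] n \<oplus> c"
        using Suc.IH[OF b] by blast
      have "sum_of_powers R n g (x [^] n \<oplus> c)"
        unfolding g sum_of_powers_Suc using x c by blast
      moreover have "a = y [^] n \<oplus> (x [^] n \<oplus> c)"
        unfolding a b' using x y sum_of_powers_closed[OF c] by (simp add: a_lcomm)
      ultimately show ?thesis using y by blast
    qed (use x a b in blast)
  qed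
  then show thesis using that by blast
qed

lemma (in ring_hom_cring) hom_sum_of_powers:
  assumes "sum_of_powers R n g a"
  shows "sum_of_powers S n g (h a)"
  using assms
proof (induction g arbitrary: a)
  case (Suc g)
  then obtain x b where x: "x \<in> carrier R" and b: "sum_of_powers R n g b"
    and a: "a = x [^] n \<oplus> b"
    by (auto simp: R.sum_of_powers_Suc)
  have "h a = h x [^]\<^bsub>S\<^esub> n \<oplus>\<^bsub>S\<^esub> h b"
    using x R.sum_of_powers_closed[OF b] by (simp add: a)
  then show ?case
    unfolding S.sum_of_powers_Suc using Suc.IH[OF b] x by blast
qed (simp add: R.sum_of_powers_0 S.sum_of_powers_0)

text \<open>Each base is lifted separately, so the number of summands is kept; the price is that
  only some preimage of \<open>b\<close> is a sum of powers, not a prescribed one.\<close>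

lemma (in ring_hom_cring) lift_sum_of_powers:
  assumes "sum_of_powers S n g b" and surj: "carrier S \<subseteq> h ` carrier R"
  obtains a where "sum_of_powers R n g a" "h a = b"
proof -
  have "\<exists>a. sum_of_powers R n g a \<and> h a = b"
    using assms(1)
  proof (induction g arbitrary: b)
    case (Suc g)
    then obtain x c where x: "x \<in> carrier S" and c: "sum_of_powers S n g c"
      and b: "b = x [^]\<^bsub>S\<^esub> n \<oplus>\<^bsub>S\<^esub> c"
      by (auto simp: S.sum_of_powers_Suc)
    obtain y where y: "y \<in> carrier R" "h y = x" using x surj by blast
    obtain d where d: "sum_of_powers R n g d" "h d = c" using Suc.IH[OF c] by blast
    have "h (y [^] n \<oplus> d) = b"
      using y d R.sum_of_powers_closed[OF d(1)] by (simp add: b)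
    then show ?case
      unfolding R.sum_of_powers_Suc using y(1) d(1) by blast
  qed (simp add: R.sum_of_powers_0 S.sum_of_powers_0)
  then show thesis using that by blast
qed

section \<open>Lengths and Waring numbers as infima in \<open>enat\<close>\<close>

lemma nlength_le: "0 < g \<Longrightarrow> sum_of_powers A n g a \<Longrightarrow> nlength A n a \<le> enat g"
  unfolding nlength_def by (rule Inf_lower) blast

lemma nlength_geI:
  assumes "\<And>g. 0 < g \<Longrightarrow> sum_of_powers A n g a \<Longrightarrow> x \<le> enat g"
  shows "x \<le> nlength A n a"
  unfolding nlength_def using assms by (intro Inf_greatest) auto

text \<open>The infimum of the empty set is infinite, so a finite infimum comes from a nonempty set,
  and \<open>enat\<close> is well-ordered.\<close>

lemma Inf_enat_Collect_attained:
  assumes "Inf {enat g | g. P g} < \<infinity>"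
  obtains g where "P g" "Inf {enat g | g. P g} = enat g"
proof -
  have "{enat g | g. P g} \<noteq> {}"
  proof
    assume "{enat g | g. P g} = {}"
    then show False using assms by (simp add: top_enat_def)
  qed
  then obtain y where y: "y \<in> {enat g | g. P g}" by blast
  have "(LEAST x. x \<in> {enat g | g. P g}) \<in> {enat g | g. P g}"
    by (rule LeastI[of "\<lambda>x. x \<in> {enat g | g. P g}", OF y])
  then have "Inf {enat g | g. P g} \<in> {enat g | g. P g}"
    using y unfolding Inf_enat_def by auto
  then show thesis using that by auto
qed

lemma nlength_attained:
  assumes "nlength A n a < \<infinity>"
  obtains g where "0 < g" "sum_of_powers A n g a" "nlength A n a = enat g"
proof (rule Inf_enat_Collect_attained)
  show "Inf {enat g | g. 0 < g \<and> sum_of_powers A n g a} < \<infinity>"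
    using assms by (simp only: nlength_def)
next
  fix g assume "0 < g \<and> sum_of_powers A n g a"
    "Inf {enat g | g. 0 < g \<and> sum_of_powers A n g a} = enat g"
  then show thesis using that[of g] by (simp only: nlength_def simp_thms)
qed

lemma waring_attained:
  assumes "waring A n < \<infinity>"
  obtains g where "0 < g" "waring A n = enat g"
    "\<forall>a \<in> carrier A. (\<exists>h>0. sum_of_powers A n h a) \<longrightarrow>
       (\<exists>h>0. h \<le> g \<and> sum_of_powers A n h a)"
proof -
  let ?P = "\<lambda>g. 0 < g \<and> (\<forall>a \<in> carrier A. (\<exists>h>0. sum_of_powers A n h a) \<longrightarrow>
        (\<exists>h>0. h \<le> g \<and> sum_of_powers A n h a))"
  show thesis
  proof (rule Inf_enat_Collect_attained)
    show "Inf {enat g | g. ?P g} < \<infinity>" using assms by (simp only: waring_def)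
  next
    fix g assume g: "?P g" "Inf {enat g | g. ?P g} = enat g"
    have "waring A n = enat g" unfolding waring_def by (rule g(2))
    with g(1) show thesis by (elim conjE) (rule that)
  qed
qed

lemma waring_le:
  assumes "0 < g"
    and "\<And>a h. a \<in> carrier A \<Longrightarrow> 0 < h \<Longrightarrow> sum_of_powers A n h a \<Longrightarrow>
       \<exists>h>0. h \<le> g \<and> sum_of_powers A n h a"
  shows "waring A n \<le> enat g"
proof -
  have "\<forall>a \<in> carrier A. (\<exists>h>0. sum_of_powers A n h a) \<longrightarrow>
      (\<exists>h>0. h \<le> g \<and> sum_of_powers A n h a)"
    using assms(2) by metis
  then show ?thesis
    unfolding waring_def by (intro Inf_lower CollectI exI[of _ g] conjI refl assms(1))
qed

text \<open>Common scheme for all comparisons of Waring numbers: a sum \<open>a\<close> is traded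
  for a companion \<open>b\<close> in \<open>B\<close>, \<open>b\<close> is shortened there, and the
  short representation is carried back to \<open>a\<close>.\<close>

lemma waring_cong:
  assumes "\<And>a h. a \<in> carrier A \<Longrightarrow> 0 < h \<Longrightarrow> sum_of_powers A n h a \<Longrightarrow>
      \<exists>b \<in> carrier B. sum_of_powers B m h b \<and>
        (\<forall>g. sum_of_powers B m g b \<longrightarrow> sum_of_powers A n g a)"
  shows "waring A n \<le> waring B m"
proof (cases "waring B m < \<infinity>")
  case True
  then obtain g where g: "0 < g" "waring B m = enat g"
    "\<forall>a \<in> carrier B. (\<exists>h>0. sum_of_powers B m h a) \<longrightarrow>
       (\<exists>h>0. h \<le> g \<and> sum_of_powers B m h a)"
    by (rule waring_attained)
  show ?thesis
    unfolding g(2)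
  proof (rule waring_le[OF g(1)])
    fix a h assume "a \<in> carrier A" "0 < h" "sum_of_powers A n h a"
    then obtain b where b: "b \<in> carrier B" "sum_of_powers B m h b"
      and *: "\<And>g. sum_of_powers B m g b \<Longrightarrow> sum_of_powers A n g a"
      using assms by metis
    obtain i where "0 < i" "i \<le> g" "sum_of_powers B m i b"
      using g(3) b \<open>0 < h\<close> by metis
    then show "\<exists>h>0. h \<le> g \<and> sum_of_powers A n h a" using * by metis
  qed
qed auto

section \<open>The characteristic and the additivity of Frobenius powers\<close>

lemma (in cring) add_pow_one_mult:
  "[(a * b)] \<cdot> \<one> = ([(a::nat)] \<cdot> \<one>) \<otimes> ([(b::nat)] \<cdot> \<one>)"
  by (simp add: add_pow_ldistr add.nat_pow_pow mult.commute)

text \<open>For positive characteristic, reduce \<open>c\<close> modulo it and use minimality.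
  Characteristic 0 fits as well, because 0 divides only 0.\<close>

lemma (in ring) ring_char_dvd_iff:
  "ring_char R dvd c \<longleftrightarrow> [c] \<cdot> \<one> = \<zero>"
proof (cases "\<exists>c::nat. 0 < c \<and> [c] \<cdot> \<one> = \<zero>")
  case True
  let ?P = "\<lambda>c::nat. 0 < c \<and> [c] \<cdot> \<one> = \<zero>"
  let ?p = "ring_char R"
  have p: "?p = (LEAST c. ?P c)" unfolding ring_char_def by (rule if_P) (rule True)
  have P: "?P ?p" unfolding p by (rule LeastI_ex[of ?P]) (rule True)
  have "[(?p * d)] \<cdot> \<one> = \<zero>" for d
    using add.nat_pow_pow[of \<one> d ?p] P by (simp add: mult.commute)
  moreover have "[c] \<cdot> \<one> = [(?p * (c div ?p))] \<cdot> \<one> \<oplus> [(c mod ?p)] \<cdot> \<one>"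
    by (simp add: add.nat_pow_mult)
  ultimately have *: "[c] \<cdot> \<one> = [(c mod ?p)] \<cdot> \<one>" by simp
  have "\<not> ?P (c mod ?p)"
    unfolding p by (rule not_less_Least) (use P p in simp)
  then show ?thesis unfolding * by (cases "c mod ?p = 0") auto
next
  case False
  then have "ring_char R = 0" by (simp only: ring_char_def if_False)
  moreover have "[c] \<cdot> \<one> \<noteq> \<zero>" if "c \<noteq> 0" using False that by blast
  ultimately show ?thesis by (cases "c = 0") (simp_all del: add_pow_def)
qed

lemma (in domain) prime_ring_char:
  assumes "0 < ring_char R"
  shows "prime (ring_char R)"
proof (rule prime_natI)
  have "\<not> ring_char R dvd 1" unfolding ring_char_dvd_iff by simp
  then show "2 \<le> ring_char R" using assms by (cases "ring_char R = 1") auto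
next
  fix a b assume "ring_char R dvd a * b"
  then show "ring_char R dvd a \<or> ring_char R dvd b"
    unfolding ring_char_dvd_iff add_pow_one_mult
    by (intro integral) simp_all
qed

lemma (in cring) binomial:
  assumes a: "a \<in> carrier R" and b: "b \<in> carrier R"
  shows "(a \<oplus> b) [^] n = (\<Oplus>k\<in>{..n}. [(n choose k)] \<cdot> (a [^] k \<otimes> b [^] (n - k)))"
proof (induction n)
  case 0
  show ?case by simp
next
  case (Suc n)
  let ?t = "\<lambda>n N k. [(n choose k)] \<cdot> (a [^] k \<otimes> b [^] (N - k))"
  note closed = a b
  have "(\<Oplus>k\<in>{..Suc n}. ?t (Suc n) (Suc n) k)
      = (\<Oplus>k\<in>{..n}. ?t (Suc n) (Suc n) (Suc k)) \<oplus> ?t (Suc n) (Suc n) 0"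
    using closed by (subst finsum_Suc2) auto
  \<comment> \<open>Pascal's rule. The terms with \<open>n choose k\<close> will sum to
    \<open>a\<close> times the expansion for \<open>n\<close>; those with
    \<open>n choose Suc k\<close>, joined by the term of index 0, to \<open>b\<close> times
    it.\<close>
  also have "(\<Oplus>k\<in>{..n}. ?t (Suc n) (Suc n) (Suc k))
      = (\<Oplus>k\<in>{..n}. a \<otimes> ?t n n k \<oplus> ?t n (Suc n) (Suc k))"
    using closed
    by (intro finsum_cong') (auto simp: add.nat_pow_mult[symmetric] add_pow_rdistr m_ac)
  also have "\<dots> = (\<Oplus>k\<in>{..n}. a \<otimes> ?t n n k) \<oplus> (\<Oplus>k\<in>{..n}. ?t n (Suc n) (Suc k))"
    using closed by (intro finsum_addf) auto
  also have "(\<Oplus>k\<in>{..n}. a \<otimes> ?t n n k) = a \<otimes> (a \<oplus> b) [^] n"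
    unfolding Suc.IH using closed by (subst finsum_rdistr) auto
  also have "\<dots> \<oplus> (\<Oplus>k\<in>{..n}. ?t n (Suc n) (Suc k)) \<oplus> ?t (Suc n) (Suc n) 0
      = a \<otimes> (a \<oplus> b) [^] n \<oplus> ((\<Oplus>k\<in>{..n}. ?t n (Suc n) (Suc k)) \<oplus> ?t n (Suc n) 0)"
    using closed by (subst a_assoc) (auto intro!: finsum_closed)
  also have "(\<Oplus>k\<in>{..n}. ?t n (Suc n) (Suc k)) \<oplus> ?t n (Suc n) 0
      = (\<Oplus>k\<in>{..Suc n}. ?t n (Suc n) k)"
    using closed by (subst finsum_Suc2) auto
  \<comment> \<open>The top term vanishes because \<open>n choose Suc n\<close> is 0.\<close>
  also have "\<dots> = (\<Oplus>k\<in>{..n}. ?t n (Suc n) k)"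
    using closed by (subst finsum_Suc) (auto simp: Pi_def binomial_eq_0)
  also have "\<dots> = (\<Oplus>k\<in>{..n}. b \<otimes> ?t n n k)"
    using closed by (intro finsum_cong') (auto simp: add_pow_rdistr m_ac Suc_diff_le)
  also have "\<dots> = b \<otimes> (a \<oplus> b) [^] n"
    unfolding Suc.IH using closed by (subst finsum_rdistr) auto
  also have "a \<otimes> (a \<oplus> b) [^] n \<oplus> b \<otimes> (a \<oplus> b) [^] n = (a \<oplus> b) [^] Suc n"
    using closed by (simp add: r_distr m_comm[of "(a \<oplus> b) [^] n"])
  finally show ?case by simp
qed

text \<open>In the binomial expansion \<open>p\<close> divides every coefficient except the first
  and the last.\<close>

lemma (in cring) frobenius_add:
  fixes p :: nat
  assumes p: "prime p" "[p] \<cdot> \<one> = \<zero>" and ab: "a \<in> carrier R" "b \<in> carrier R"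
  shows "(a \<oplus> b) [^] p = a [^] p \<oplus> b [^] p"
proof -
  let ?t = "\<lambda>k. [(p choose k)] \<cdot> (a [^] k \<otimes> b [^] (p - k))"
  \<comment> \<open>In this form the two extreme terms split off, and the inner indices are
    \<open>Suc k\<close> with \<open>k\<close> at most \<open>r\<close>.\<close>
  obtain r where r: "p = Suc (Suc r)"
    using prime_ge_2_nat[OF p(1)] that[of "p - 2"] by simp
  have t0: "?t (Suc k) = \<zero>" if "k \<le> r" for k
  proof -
    have "p dvd (p choose Suc k)"
      by (rule dvd_choose_prime) (use that r p in auto)
    then obtain c where c: "p choose Suc k = p * c" by blast
    define x where "x = a [^] Suc k \<otimes> b [^] (p - Suc k)"
    have x: "x \<in> carrier R" unfolding x_def using ab by blast
    have "[(p choose Suc k)] \<cdot> x = ([(p choose Suc k)] \<cdot> \<one>) \<otimes> x"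
      using x by (simp add: add_pow_ldistr)
    also have "\<dots> = \<zero>"
      unfolding c add_pow_one_mult p(2) using x by simp
    finally show ?thesis unfolding x_def .
  qed
  have t: "?t \<in> A \<rightarrow> carrier R" "(\<lambda>k. ?t (Suc k)) \<in> A \<rightarrow> carrier R" for A
    using ab by auto
  have "(a \<oplus> b) [^] p = (\<Oplus>k\<in>{..Suc (Suc r)}. ?t k)"
    using binomial[OF ab, of p] r by simp
  also have "\<dots> = (\<Oplus>k\<in>{..Suc r}. ?t (Suc k)) \<oplus> ?t 0"
    by (rule finsum_Suc2[OF t(1)])
  also have "(\<Oplus>k\<in>{..Suc r}. ?t (Suc k)) = ?t p \<oplus> (\<Oplus>k\<in>{..r}. ?t (Suc k))"
    unfolding r by (rule finsum_Suc) (use t r in simp)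
  also have "(\<Oplus>k\<in>{..r}. ?t (Suc k)) = (\<Oplus>k\<in>{..r}. \<zero>)"
    by (rule finsum_cong') (use t0 in auto)
  finally show ?thesis using ab by simp
qed

lemma (in cring) frobenius_pow_add:
  fixes p :: nat
  assumes "prime p" "[p] \<cdot> \<one> = \<zero>" "a \<in> carrier R" "b \<in> carrier R"
  shows "(a \<oplus> b) [^] (p ^ j) = a [^] (p ^ j) \<oplus> b [^] (p ^ j)"
proof (induction j)
  case (Suc j)
  have "x [^] (p ^ Suc j) = (x [^] (p ^ j)) [^] p" if "x \<in> carrier R" for x
    using that using nat_pow_pow[OF that, of "p ^ j" p] by (simp add: mult.commute)
  then show ?case using Suc frobenius_add[OF assms(1,2)] assms(3,4) by simp
qed (use assms in simp)

section \<open>Passing between the exponents \<open>q * m\<close> and \<open>m\<close> when q-th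
  powers are additive\<close>

lemma (in cring) sum_of_powers_pow:
  assumes add: "\<forall>a \<in> carrier R. \<forall>b \<in> carrier R.
      (a \<oplus> b) [^] q = a [^] q \<oplus> b [^] q"
    and q: "0 < (q::nat)" and "sum_of_powers R m g a"
  shows "sum_of_powers R (q * m) g (a [^] q)"
  using assms(3)
proof (induction g arbitrary: a)
  case 0
  then show ?case using q by (simp add: sum_of_powers_0 nat_pow_zero)
next
  case (Suc g)
  then obtain x b where x: "x \<in> carrier R" and b: "sum_of_powers R m g b"
    and a: "a = x [^] m \<oplus> b"
    by (auto simp: sum_of_powers_Suc)
  have "a [^] q = x [^] (q * m) \<oplus> b [^] q"
    unfolding a using x sum_of_powers_closed[OF b]
    by (simp add: add nat_pow_pow mult.commute)
  then show ?case
    unfolding sum_of_powers_Suc using Suc.IH[OF b] x by blast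
qed

lemma (in cring) sum_of_powers_root:
  assumes add: "\<forall>a \<in> carrier R. \<forall>b \<in> carrier R.
      (a \<oplus> b) [^] q = a [^] q \<oplus> b [^] q"
    and q: "0 < (q::nat)" and "sum_of_powers R (q * m) g a"
  obtains b where "sum_of_powers R m g b" "a = b [^] q"
proof -
  have "\<exists>b. sum_of_powers R m g b \<and> a = b [^] q"
    using assms(3)
  proof (induction g arbitrary: a)
    case 0
    then show ?case using q by (simp add: sum_of_powers_0 nat_pow_zero)
  next
    case (Suc g)
    then obtain x b where x: "x \<in> carrier R" and b: "sum_of_powers R (q * m) g b"
      and a: "a = x [^] (q * m) \<oplus> b"
      by (auto simp: sum_of_powers_Suc)
    obtain c where c: "sum_of_powers R m g c" "b = c [^] q"
      using Suc.IH[OF b] by blast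
    have "a = (x [^] m \<oplus> c) [^] q"
      unfolding a c(2) using x sum_of_powers_closed[OF c(1)]
      by (simp add: add nat_pow_pow mult.commute)
    then show ?case
      unfolding sum_of_powers_Suc using c(1) x by blast
  qed
  then show thesis using that by blast
qed

text \<open>Injectivity enters in the second inequality: a short sum of powers with exponent
  \<open>q * m\<close> equal to \<open>a [^] q\<close> has a q-th root that is a sum of m-th powers,
  and this root must be \<open>a\<close> itself.\<close>

lemma (in cring) waring_mult:
  assumes add: "\<forall>a \<in> carrier R. \<forall>b \<in> carrier R.
      (a \<oplus> b) [^] q = a [^] q \<oplus> b [^] q"
    and inj: "inj_on (\<lambda>a. a [^] q) (carrier R)"
    and q: "0 < (q::nat)"
  shows "waring R (q * m) = waring R m"
proof (rule antisym)
  show "waring R (q * m) \<le> waring R m"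
  proof (rule waring_cong)
    fix a h assume "sum_of_powers R (q * m) h a"
    then obtain b where b: "sum_of_powers R m h b" "a = b [^] q"
      by (rule sum_of_powers_root[OF add q])
    then show "\<exists>b \<in> carrier R. sum_of_powers R m h b \<and>
        (\<forall>g. sum_of_powers R m g b \<longrightarrow> sum_of_powers R (q * m) g a)"
      using sum_of_powers_pow[OF add q] sum_of_powers_closed[OF b(1)] by blast
  qed
  show "waring R m \<le> waring R (q * m)"
  proof (rule waring_cong)
    fix a h assume a: "a \<in> carrier R" "sum_of_powers R m h a"
    have "sum_of_powers R m g a" if sum: "sum_of_powers R (q * m) g (a [^] q)" for g
    proof -
      obtain c where c: "sum_of_powers R m g c" "a [^] q = c [^] q"
        using sum by (rule sum_of_powers_root[OF add q])
      then have "a = c" using inj_onD[OF inj c(2)] a sum_of_powers_closed by blast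
      then show ?thesis using c(1) by simp
    qed
    then show "\<exists>b \<in> carrier R. sum_of_powers R (q * m) h b \<and>
        (\<forall>g. sum_of_powers R (q * m) g b \<longrightarrow> sum_of_powers R m g a)"
      using a sum_of_powers_pow[OF add q a(2)] by blast
  qed
qed

section \<open>Hensel's lemma for X^m + c\<close>

lemma henselian_power_root:
  fixes R (structure) and m :: nat
  assumes hens: "henselian M R" and b: "b \<in> carrier R" and c: "c \<in> carrier R"
    and m: "0 < m" and root: "b [^] m \<oplus> c \<in> M"
    and deriv: "([m] \<cdot> \<one>) \<otimes> b [^] (m - 1) \<notin> M"
  obtains a where "a \<in> carrier R" "a [^] m \<oplus> c = \<zero>"
proof -
  interpret local_ring M R using hens by (simp add: henselian_def)
  interpret U: UP_cring R "UP R" by unfold_locales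
  \<comment> \<open>Not interpreted: for the identity map the simp rule \<open>hom_finsum\<close> loops.\<close>
  have eval: "UP_pre_univ_prop R R (\<lambda>c. c)"
    by (intro UP_pre_univ_prop.intro ring_hom_cringI U.UP_cring_axioms is_cring)
      (simp add: ring_hom_def)
  define f where "f = monom (UP R) \<one> m \<oplus>\<^bsub>UP R\<^esub> monom (UP R) c 0"
  have f: "f \<in> carrier (UP R)" unfolding f_def using c by simp
  have val: "poly_value R f x = x [^] m \<oplus> c" if "x \<in> carrier R" for x
  proof -
    have "poly_value R f x =
        poly_value R (monom (UP R) \<one> m) x \<oplus> poly_value R (monom (UP R) c 0) x"
      unfolding f_def poly_value_def
      by (rule ring_hom_add[OF UP_pre_univ_prop.eval_ring_hom[OF eval]]) (use c that in auto)
    then show ?thesis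
      unfolding poly_value_def using c that by (simp add: UP_pre_univ_prop.eval_monom[OF eval])
  qed
  \<comment> \<open>Compared coefficientwise: the shift in \<open>UP_deriv\<close> drops the
    constant term and leaves m X^(m-1).\<close>
  have "UP_deriv R f = monom (UP R) ([m] \<cdot> \<one>) (m - 1)"
  proof (rule U.up_eqI)
    fix i
    have "up_ring.coeff (UP R) (UP_deriv R f) i = UP_deriv R f i"
      using UP_deriv_closed[OF f] by (simp add: UP_def)
    also have "\<dots> = up_ring.coeff (UP R) (monom (UP R) ([m] \<cdot> \<one>) (m - 1)) i"
      unfolding UP_deriv_def f_def using c m by (cases m) auto
    finally show "up_ring.coeff (UP R) (UP_deriv R f) i =
      up_ring.coeff (UP R) (monom (UP R) ([m] \<cdot> \<one>) (m - 1)) i" .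
  qed (use UP_deriv_closed[OF f] in auto)
  then have "poly_value R (UP_deriv R f) b = ([m] \<cdot> \<one>) \<otimes> b [^] (m - 1)"
    using b by (simp add: poly_value_def UP_pre_univ_prop.eval_monom[OF eval])
  with root deriv have "poly_value R f b \<in> M \<and> poly_value R (UP_deriv R f) b \<notin> M"
    by (simp add: val[OF b])
  then obtain a where a: "a \<in> carrier R" "poly_value R f a = \<zero>"
    using hens f b unfolding henselian_def by blast
  then show thesis using that[OF a(1)] val[OF a(1)] by simp
qed

section \<open>Comparison of a ring with its residue field\<close>

lemma (in ring_hom_cring) hom_add_pow_one: "h ([n] \<cdot> \<one>) = [(n::nat)] \<cdot>\<^bsub>S\<^esub> \<one>\<^bsub>S\<^esub>"
  by (induction n) simp_all

text \<open>First-order expansion modulo the square of \<open>M\<close>: in the induction step the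
  new terms m t^2 and r t both fall into that square.\<close>

lemma (in cring) one_plus_pow:
  assumes M: "ideal M R" and t: "t \<in> M"
  shows "\<exists>r \<in> M \<cdot> M. (\<one> \<oplus> t) [^] m = (\<one> \<oplus> [(m::nat)] \<cdot> t) \<oplus> r"
proof (induction m)
  interpret M: ideal M R by fact
  interpret MM: ideal "M \<cdot> M" R by (rule ideal_prod_is_ideal[OF M M])
  note tR = M.Icarr[OF t]
  {
    case 0
    show ?case using MM.zero_closed by (intro bexI[of _ \<zero>]) simp_all
  next
    case (Suc m)
    then obtain r where r: "r \<in> M \<cdot> M" and IH: "(\<one> \<oplus> t) [^] m = (\<one> \<oplus> [m] \<cdot> t) \<oplus> r"
      by blast
    note rR = MM.Icarr[OF r]
    have "[m] \<cdot> t = ([m] \<cdot> \<one>) \<otimes> t" using tR by (simp add: add_pow_ldistr)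
    then have mt: "[m] \<cdot> t \<in> M" using M.I_l_closed[OF t, of "[m] \<cdot> \<one>"] by simp
    define u where "u = [m] \<cdot> t"
    have u: "u \<in> carrier R" "u \<in> M" using mt tR by (simp_all add: u_def)
    have "(\<one> \<oplus> t) [^] Suc m = ((\<one> \<oplus> u) \<oplus> r) \<otimes> (\<one> \<oplus> t)"
      using IH by (simp add: u_def)
    also have "\<dots> = (\<one> \<oplus> (u \<oplus> t)) \<oplus> (r \<oplus> u \<otimes> t \<oplus> r \<otimes> t)"
      using tR rR u by (simp add: l_distr r_distr a_ac)
    also have "u \<oplus> t = [Suc m] \<cdot> t" unfolding u_def by simp
    finally show ?case
      using MM.a_closed[OF MM.a_closed[OF r ideal_prod.prod[OF u(2) t]] MM.I_r_closed[OF r tR]]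
      by blast
  }
qed

text \<open>The residue map enters only as a surjection onto a field with kernel \<open>M\<close>,
  so the arguments below never handle cosets.\<close>

locale residue_field_hom = ring_hom_cring R S h + S?: field S
  for R (structure) and S (structure) and h +
  fixes M
  assumes ideal_M: "ideal M R"
    and hom_eq_zero_iff: "x \<in> carrier R \<Longrightarrow> h x = \<zero>\<^bsub>S\<^esub> \<longleftrightarrow> x \<in> M"
    and surj: "carrier S \<subseteq> h ` carrier R"
begin

lemma in_M: "h x = \<zero>\<^bsub>S\<^esub> \<Longrightarrow> x \<in> carrier R \<Longrightarrow> x \<in> M"
  using hom_eq_zero_iff by blast

lemma minus_one_not_zero: "\<ominus>\<^bsub>S\<^esub> \<one>\<^bsub>S\<^esub> \<noteq> \<zero>\<^bsub>S\<^esub>"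
  using S.minus_minus[of "\<one>\<^bsub>S\<^esub>"] S.one_not_zero by fastforce

lemma pow_not_zero:
  "x \<in> carrier S \<Longrightarrow> x \<noteq> \<zero>\<^bsub>S\<^esub> \<Longrightarrow> x [^]\<^bsub>S\<^esub> (n::nat) \<noteq> \<zero>\<^bsub>S\<^esub>"
  by (induction n) (auto simp: S.integral_iff)

text \<open>A power with exponent \<open>q * m\<close> is an m-th power, and \<open>h\<close> sends
  -1 to -1.\<close>

lemma nlevel_mono: "nlevel S m \<le> nlevel R (q * m)"
  unfolding nlevel_def
proof (rule nlength_geI)
  fix g assume g: "0 < g" "sum_of_powers R (q * m) g (\<ominus> \<one>)"
  have "sum_of_powers S m g (h (\<ominus> \<one>))"
    by (rule hom_sum_of_powers[OF R.sum_of_powers_dvd[OF g(2)]])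
  then show "nlength S m (\<ominus>\<^bsub>S\<^esub> \<one>\<^bsub>S\<^esub>) \<le> enat g"
    using nlength_le[OF g(1)] by simp
qed

lemma waring_mono: "waring S m \<le> waring R m"
proof (rule waring_cong)
  fix a i assume "sum_of_powers S m i a"
  then obtain b where b: "sum_of_powers R m i b" "h b = a"
    by (rule lift_sum_of_powers[OF _ surj])
  then show "\<exists>b \<in> carrier R. sum_of_powers R m i b \<and>
      (\<forall>g. sum_of_powers R m g b \<longrightarrow> sum_of_powers S m g a)"
    using hom_sum_of_powers R.sum_of_powers_closed by blast
qed

text \<open>Only the nonzero summand is adjusted: \<open>b\<close> lifts to a sum \<open>c\<close>
  of \<open>g\<close> m-th powers, and Hensel's lemma moves a lift of \<open>x\<close> to a root of
  X^m + (c - a). The derivative is a unit modulo \<open>M\<close> because \<open>m\<close> and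
  \<open>x\<close> are nonzero in the field.\<close>

lemma hensel_sum_of_powers_Suc:
  assumes hens: "henselian M R" and m: "[m] \<cdot>\<^bsub>S\<^esub> \<one>\<^bsub>S\<^esub> \<noteq> \<zero>\<^bsub>S\<^esub>"
    and x: "x \<in> carrier S" "x \<noteq> \<zero>\<^bsub>S\<^esub>" and b: "sum_of_powers S m g b"
    and a: "a \<in> carrier R" "h a = x [^]\<^bsub>S\<^esub> m \<oplus>\<^bsub>S\<^esub> b"
  shows "sum_of_powers R m (Suc g) a"
proof -
  have m0: "0 < m" using m by (cases m) auto
  obtain y where y: "y \<in> carrier R" "h y = x" using x(1) surj by blast
  obtain c where c: "sum_of_powers R m g c" "h c = b"
    using b by (rule lift_sum_of_powers[OF _ surj])
  note cR = R.sum_of_powers_closed[OF c(1)]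
  note bS = S.sum_of_powers_closed[OF b]
  have "h (y [^] m \<oplus> (c \<ominus> a)) = \<zero>\<^bsub>S\<^esub>"
    using y c(2) cR a x(1) bS
    by (simp add: R.minus_eq S.minus_add S.a_ac S.r_neg S.r_neg1 S.r_neg2)
  then have root: "y [^] m \<oplus> (c \<ominus> a) \<in> M"
    using y(1) cR a(1) by (intro in_M) simp_all
  have "h (([m] \<cdot> \<one>) \<otimes> y [^] (m - 1)) \<noteq> \<zero>\<^bsub>S\<^esub>"
    using y m x pow_not_zero[OF x] by (simp add: hom_add_pow_one S.integral_iff)
  then have "([m] \<cdot> \<one>) \<otimes> y [^] (m - 1) \<notin> M"
    using hom_eq_zero_iff[of "([m] \<cdot> \<one>) \<otimes> y [^] (m - 1)"] y(1) by auto
  then obtain z where z: "z \<in> carrier R" "z [^] m \<oplus> (c \<ominus> a) = \<zero>"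
    using henselian_power_root[OF hens y(1) _ m0 root] cR a(1) by blast
  have "a = z [^] m \<oplus> (c \<ominus> a) \<oplus> a" using z(2) a(1) by simp
  also have "\<dots> = z [^] m \<oplus> c"
    using z(1) cR a(1) by (simp add: R.minus_eq R.a_assoc R.l_neg)
  finally show ?thesis
    unfolding R.sum_of_powers_Suc using z(1) c(1) by blast
qed

text \<open>A nonzero residue cannot be a sum of zeros only, so its representation has a nonzero
  summand to adjust.\<close>

lemma hensel_sum_of_powers:
  assumes hens: "henselian M R" and m: "[m] \<cdot>\<^bsub>S\<^esub> \<one>\<^bsub>S\<^esub> \<noteq> \<zero>\<^bsub>S\<^esub>"
    and a: "a \<in> carrier R" "a \<notin> M" and sum: "sum_of_powers S m g (h a)"
  shows "sum_of_powers R m g a"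
proof -
  have m0: "0 < m" using m by (cases m) auto
  from sum obtain g' x b where "g = Suc g'" "x \<in> carrier S" "x \<notin> {\<zero>\<^bsub>S\<^esub>}"
    "sum_of_powers S m g' b" "h a = x [^]\<^bsub>S\<^esub> m \<oplus>\<^bsub>S\<^esub> b"
    by (rule S.sum_of_powers_split[where N = "{\<zero>\<^bsub>S\<^esub>}" and I = "{\<zero>\<^bsub>S\<^esub>}"])
      (use m0 a hom_eq_zero_iff[OF a(1)] in \<open>auto simp: S.nat_pow_zero\<close>)
  then show ?thesis using hensel_sum_of_powers_Suc[OF hens m] a(1) by simp
qed

text \<open>Outside \<open>M\<close> a shortest representation of the residue lifts with the same
  length. Inside \<open>M\<close> the residue is 0 = 1^m + (-1), which costs one summand more than
  the level.\<close>

lemma waring_le_max: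
  assumes hens: "henselian M R" and m: "[m] \<cdot>\<^bsub>S\<^esub> \<one>\<^bsub>S\<^esub> \<noteq> \<zero>\<^bsub>S\<^esub>"
    and level: "nlevel S m < \<infinity>"
  shows "waring R m \<le> max (waring S m) (nlevel S m + 1)"
proof (cases "waring S m < \<infinity>")
  case True
  then obtain g where g: "0 < g" "waring S m = enat g"
    "\<forall>a \<in> carrier S. (\<exists>i>0. sum_of_powers S m i a) \<longrightarrow>
       (\<exists>i>0. i \<le> g \<and> sum_of_powers S m i a)"
    by (rule waring_attained)
  obtain s where s: "0 < s" "sum_of_powers S m s (\<ominus>\<^bsub>S\<^esub> \<one>\<^bsub>S\<^esub>)" "nlevel S m = enat s"
    using level unfolding nlevel_def by (rule nlength_attained)
  have "waring R m \<le> enat (max g (Suc s))"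
  proof (rule waring_le)
    fix a i assume a: "a \<in> carrier R" and i: "0 < i" "sum_of_powers R m i a"
    show "\<exists>j>0. j \<le> max g (Suc s) \<and> sum_of_powers R m j a"
    proof (cases "a \<in> M")
      case True
      then have "h a = \<one>\<^bsub>S\<^esub> [^]\<^bsub>S\<^esub> m \<oplus>\<^bsub>S\<^esub> \<ominus>\<^bsub>S\<^esub> \<one>\<^bsub>S\<^esub>"
        using hom_eq_zero_iff[OF a] by (simp add: S.r_neg)
      then have "sum_of_powers R m (Suc s) a"
        by (intro hensel_sum_of_powers_Suc[where x = "\<one>\<^bsub>S\<^esub>", OF hens m _ _ s(2) a]) simp_all
      then show ?thesis by (intro exI[of _ "Suc s"]) simp
    next
      case False
      obtain j where j: "0 < j" "j \<le> g" "sum_of_powers S m j (h a)"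
        using g(3) i hom_sum_of_powers[OF i(2)] hom_closed[OF a] by metis
      have "sum_of_powers R m j a"
        by (rule hensel_sum_of_powers[OF hens m a False j(3)])
      then show ?thesis using j by (intro exI[of _ j]) simp
    qed
  qed simp
  also have "enat (max g (Suc s)) = max (waring S m) (nlevel S m + 1)"
    unfolding g(2) s(3) one_enat_def by (simp add: max_def)
  finally show ?thesis .
qed simp

lemma nlevel_eq:
  assumes hens: "henselian M R" and m: "[m] \<cdot>\<^bsub>S\<^esub> \<one>\<^bsub>S\<^esub> \<noteq> \<zero>\<^bsub>S\<^esub>"
    and level: "nlevel S m < \<infinity>"
    and add: "\<forall>a \<in> carrier R. \<forall>b \<in> carrier R.
      (a \<oplus> b) [^] q = a [^] q \<oplus> b [^] q"
    and q: "0 < (q::nat)"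
  shows "nlevel R (q * m) = nlevel S m"
proof (rule antisym)
  obtain s where s: "0 < s" "sum_of_powers S m s (\<ominus>\<^bsub>S\<^esub> \<one>\<^bsub>S\<^esub>)" "nlevel S m = enat s"
    using level unfolding nlevel_def by (rule nlength_attained)
  have "\<ominus> \<one> \<notin> M"
    using hom_eq_zero_iff[of "\<ominus> \<one>"] minus_one_not_zero by simp
  then have "sum_of_powers R m s (\<ominus> \<one>)"
    using s(2) by (intro hensel_sum_of_powers[OF hens m]) simp_all
  then have "sum_of_powers R (q * m) s ((\<ominus> \<one>) [^] q)"
    by (rule R.sum_of_powers_pow[OF add q])
  \<comment> \<open>No parity of \<open>q\<close> is consulted: additivity gives 0 = (1 + (-1))^q =
    1 + (-1)^q, which also covers even \<open>q\<close>.\<close>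
  moreover have "(\<ominus> \<one>) [^] q = \<ominus> \<one>"
  proof -
    have "\<one> \<oplus> (\<ominus> \<one>) [^] q = (\<one> \<oplus> \<ominus> \<one>) [^] q" using add by (metis R.a_inv_closed R.nat_pow_one R.one_closed)
    also have "\<dots> = \<zero>" using q by (simp add: R.r_neg R.nat_pow_zero)
    finally show ?thesis
      using R.minus_equality[of "(\<ominus> \<one>) [^] q" \<one>] by (simp add: R.a_comm)
  qed
  ultimately show "nlevel R (q * m) \<le> nlevel S m"
    unfolding s(3) unfolding nlevel_def using nlength_le[OF s(1)] by simp
qed (rule nlevel_mono)

lemma nlength_ge:
  assumes f: "f \<in> M" "f \<notin> M \<cdot> M" and m: "1 < m" and q: "0 < q"
  shows "nlevel S m + 1 \<le> nlength R (q * m) f"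
proof (rule nlength_geI)
  interpret M: ideal M R by (rule ideal_M)
  interpret MM: ideal "M \<cdot> M" R by (rule R.ideal_prod_is_ideal[OF ideal_M ideal_M])
  have "1 < q * m" using m q by (metis less_1_mult mult.right_neutral mult.commute nat_neq_iff less_one)
  \<comment> \<open>The exponent is at least 2, so a power of an element of \<open>M\<close> is a
    product of two elements of \<open>M\<close>.\<close>
  define k where "k = q * m - 2"
  have k: "q * m = Suc (Suc k)" unfolding k_def using \<open>1 < q * m\<close> by simp
  fix g assume "sum_of_powers R (q * m) g f"
  then obtain g' x b where g': "g = Suc g'" and x: "x \<in> carrier R" "x \<notin> M"
    and b: "sum_of_powers R (q * m) g' b" and f_eq: "f = x [^] (q * m) \<oplus> b"
  proof (rule R.sum_of_powers_split[where N = M and I = "M \<cdot> M"])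
    fix y assume y: "y \<in> M"
    have "y [^] Suc k \<in> M" using M.I_l_closed[OF y, of "y [^] k"] M.Icarr[OF y] by simp
    then show "y [^] (q * m) \<in> M \<cdot> M" unfolding k using y by (simp add: ideal_prod.prod)
  qed (use f MM.zero_closed MM.a_closed in auto)
  have hb: "sum_of_powers S m g' (h b)"
    by (rule hom_sum_of_powers[OF R.sum_of_powers_dvd[OF b]])
  note bR = R.sum_of_powers_closed[OF b]
  \<comment> \<open>Chosen so that the residue of the split-off summand is the m-th power of
    \<open>y\<close>; multiplying \<open>h b\<close> by the m-th power of the inverse of
    \<open>y\<close> then yields -1.\<close>
  define y where "y = h x [^]\<^bsub>S\<^esub> q"
  have y: "y \<in> carrier S" "y \<noteq> \<zero>\<^bsub>S\<^esub>"
    unfolding y_def using x hom_eq_zero_iff[OF x(1)] pow_not_zero by simp_all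
  have "h f = \<zero>\<^bsub>S\<^esub>" using hom_eq_zero_iff f M.Icarr by blast
  then have "y [^]\<^bsub>S\<^esub> m \<oplus>\<^bsub>S\<^esub> h b = \<zero>\<^bsub>S\<^esub>"
    unfolding f_eq y_def using x(1) bR by (simp add: S.nat_pow_pow)
  then have hb_eq: "h b = \<ominus>\<^bsub>S\<^esub> (y [^]\<^bsub>S\<^esub> m)"
    using S.minus_equality[of "h b" "y [^]\<^bsub>S\<^esub> m"] y(1) bR by (simp add: S.a_comm)
  have yU: "y \<in> Units S" using y S.field_Units by simp
  define z where "z = inv\<^bsub>S\<^esub> y"
  have z: "z \<in> carrier S" "z \<otimes>\<^bsub>S\<^esub> y = \<one>\<^bsub>S\<^esub>" unfolding z_def using yU by simp_all
  have "z [^]\<^bsub>S\<^esub> m \<otimes>\<^bsub>S\<^esub> h b = \<ominus>\<^bsub>S\<^esub> ((z \<otimes>\<^bsub>S\<^esub> y) [^]\<^bsub>S\<^esub> m)"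
    unfolding hb_eq using z(1) y(1) by (simp add: S.r_minus S.nat_pow_distrib)
  then have "z [^]\<^bsub>S\<^esub> m \<otimes>\<^bsub>S\<^esub> h b = \<ominus>\<^bsub>S\<^esub> \<one>\<^bsub>S\<^esub>" unfolding z(2) by simp
  then have sum: "sum_of_powers S m g' (\<ominus>\<^bsub>S\<^esub> \<one>\<^bsub>S\<^esub>)"
    using S.sum_of_powers_mult[OF hb z(1)] by simp
  \<comment> \<open>Lengths count only positive numbers of summands; an empty sum would give -1 =
    0.\<close>
  then have "0 < g'" using minus_one_not_zero by (cases g') (auto simp: S.sum_of_powers_0)
  then have "nlevel S m \<le> enat g'" unfolding nlevel_def using sum by (rule nlength_le)
  then show "nlevel S m + 1 \<le> enat g"
    unfolding g' by (simp add: eSuc_enat[symmetric] plus_1_eSuc)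
qed

text \<open>The length bound needs an element of \<open>M\<close> outside its square that really is
  a sum of m-th powers. Finiteness of the level provides one, via a lift \<open>c\<close> of -1.
  With infinite level the bound can fail: real power series and m = 2 have infinite level but Waring
  number 1.\<close>

lemma waring_ge:
  assumes M: "M \<noteq> M \<cdot> M" and m: "[m] \<cdot>\<^bsub>S\<^esub> \<one>\<^bsub>S\<^esub> \<noteq> \<zero>\<^bsub>S\<^esub>" and m1: "1 < m"
    and level: "nlevel S m < \<infinity>"
  shows "nlevel S m + 1 \<le> waring R m"
proof -
  interpret M: ideal M R by (rule ideal_M)
  interpret MM: ideal "M \<cdot> M" R by (rule R.ideal_prod_is_ideal[OF ideal_M ideal_M])
  obtain s where s: "0 < s" "sum_of_powers S m s (\<ominus>\<^bsub>S\<^esub> \<one>\<^bsub>S\<^esub>)" "nlevel S m = enat s"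
    using level unfolding nlevel_def by (rule nlength_attained)
  obtain c where c: "sum_of_powers R m s c" "h c = \<ominus>\<^bsub>S\<^esub> \<one>\<^bsub>S\<^esub>"
    using s(2) by (rule lift_sum_of_powers[OF _ surj])
  note cR = R.sum_of_powers_closed[OF c(1)]
  obtain t where t: "t \<in> M" "t \<notin> M \<cdot> M"
    using M R.ideal_prod_inter[OF ideal_M ideal_M] by blast
  note tR = M.Icarr[OF t(1)]
  have ht: "h t = \<zero>\<^bsub>S\<^esub>" using hom_eq_zero_iff[OF tR] t by simp
  have sums: "sum_of_powers R m (Suc s) (x [^] m \<oplus> c)" if "x \<in> carrier R" for x
    unfolding R.sum_of_powers_Suc using c(1) that by blast
  \<comment> \<open>One of \<open>1 + c\<close> and \<open>(1 + t)\<^sup>m + c\<close> avoids \<open>M\<^sup>2\<close>: they differ by \<open>m t\<close> modulo \<open>M\<^sup>2\<close>,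
    and \<open>m\<close> is invertible modulo \<open>M\<close>.\<close>
  have "\<exists>x \<in> carrier R. x [^] m \<oplus> c \<in> M \<and> x [^] m \<oplus> c \<notin> M \<cdot> M"
  proof (rule ccontr)
    assume none: "\<not> ?thesis"
    have in_MM: "x [^] m \<oplus> c \<in> M \<cdot> M" if "x \<in> carrier R" "h x = \<one>\<^bsub>S\<^esub>" for x
    proof -
      have "h (x [^] m \<oplus> c) = \<zero>\<^bsub>S\<^esub>" using that c(2) cR by (simp add: S.r_neg)
      then have "x [^] m \<oplus> c \<in> M" using that cR by (intro in_M) simp_all
      then show ?thesis using none that by blast
    qed
    obtain r where r: "r \<in> M \<cdot> M" "(\<one> \<oplus> t) [^] m = (\<one> \<oplus> [m] \<cdot> t) \<oplus> r"
      using R.one_plus_pow[OF ideal_M t(1)] by blast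
    note rR = MM.Icarr[OF r(1)]
    define u where "u = [m] \<cdot> t"
    have uR: "u \<in> carrier R" unfolding u_def using tR by simp
    have "\<ominus> (\<one> [^] m \<oplus> c) \<in> M \<cdot> M"
      by (intro MM.a_inv_closed in_MM) simp_all
    moreover have "(\<one> [^] m \<oplus> c) \<oplus> (u \<oplus> r) \<in> M \<cdot> M"
    proof -
      have "(\<one> [^] m \<oplus> c) \<oplus> (u \<oplus> r) = (\<one> \<oplus> t) [^] m \<oplus> c"
        unfolding r(2) u_def[symmetric] using cR uR rR by (simp add: R.a_ac)
      then show ?thesis using in_MM[of "\<one> \<oplus> t"] tR ht by simp
    qed
    ultimately have "\<ominus> (\<one> [^] m \<oplus> c) \<oplus> ((\<one> [^] m \<oplus> c) \<oplus> (u \<oplus> r)) \<in> M \<cdot> M"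
      by (rule MM.a_closed)
    then have "u \<oplus> r \<in> M \<cdot> M"
      using cR uR rR by (simp only: R.r_neg1 R.a_closed R.nat_pow_closed R.one_closed)
    then have "(u \<oplus> r) \<oplus> \<ominus> r \<in> M \<cdot> M"
      by (rule MM.a_closed[OF _ MM.a_inv_closed[OF r(1)]])
    then have uMM: "u \<in> M \<cdot> M" using uR rR by (simp add: R.a_assoc R.r_neg)
    \<comment> \<open>Cancelling \<open>m\<close>: with \<open>v\<close> an inverse of
      \<open>e\<close> modulo \<open>M\<close>, t = (1 - v e) t + v u, and both terms lie in the
      square of \<open>M\<close>.\<close>
    define e where "e = [m] \<cdot> \<one>"
    have eR: "e \<in> carrier R" unfolding e_def by simp
    have u_eq: "u = e \<otimes> t" unfolding u_def e_def using tR by (simp add: R.add_pow_ldistr)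
    have "h e \<in> Units S"
      using m eR by (simp add: S.field_Units e_def hom_add_pow_one)
    then have inv: "inv\<^bsub>S\<^esub> h e \<in> carrier S" "inv\<^bsub>S\<^esub> h e \<otimes>\<^bsub>S\<^esub> h e = \<one>\<^bsub>S\<^esub>"
      by simp_all
    obtain v where "v \<in> carrier R" "h v = inv\<^bsub>S\<^esub> h e"
      using inv(1) surj by (metis imageE subsetD)
    then have v: "v \<in> carrier R" "h v \<otimes>\<^bsub>S\<^esub> h e = \<one>\<^bsub>S\<^esub>"
      using inv(2) by simp_all
    have "h (\<one> \<ominus> v \<otimes> e) = \<zero>\<^bsub>S\<^esub>" using v eR by (simp add: R.minus_eq S.r_neg)
    then have "\<one> \<ominus> v \<otimes> e \<in> M" using v(1) eR by (intro in_M) simp_all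
    then have "(\<one> \<ominus> v \<otimes> e) \<otimes> t \<oplus> v \<otimes> u \<in> M \<cdot> M"
      by (rule MM.a_closed[OF ideal_prod.prod[OF _ t(1)] MM.I_l_closed[OF uMM v(1)]])
    also have "(\<one> \<ominus> v \<otimes> e) \<otimes> t \<oplus> v \<otimes> u = t"
      unfolding u_eq using v(1) eR tR
      by (simp add: R.minus_eq R.l_distr R.l_minus R.m_assoc R.a_assoc R.l_neg)
    finally show False using t(2) by simp
  qed
  then obtain x where x: "x \<in> carrier R" "x [^] m \<oplus> c \<in> M" "x [^] m \<oplus> c \<notin> M \<cdot> M"
    by blast
  let ?f = "x [^] m \<oplus> c"
  show ?thesis
  proof (cases "waring R m < \<infinity>")
    case True
    then obtain g where g: "0 < g" "waring R m = enat g"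
      "\<forall>a \<in> carrier R. (\<exists>i>0. sum_of_powers R m i a) \<longrightarrow>
         (\<exists>i>0. i \<le> g \<and> sum_of_powers R m i a)"
      by (rule waring_attained)
    obtain i where i: "0 < i" "i \<le> g" "sum_of_powers R m i ?f"
      using g(3)[rule_format, OF M.Icarr[OF x(2)]] sums[OF x(1)] by blast
    have "nlevel S m + 1 \<le> nlength R m ?f"
      using nlength_ge[OF x(2,3) m1, of 1] by simp
    also have "\<dots> \<le> enat i" by (rule nlength_le[OF i(1,3)])
    also have "\<dots> \<le> waring R m" using i(2) g(2) by simp
    finally show ?thesis .
  qed auto
qed

end

section \<open>The quotient by the maximal ideal and the assembly of the statements\<close>

lemma (in local_ring) residue_field_hom_quot: "residue_field_hom R (R Quot M) ((+>) M) M"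
proof (intro residue_field_hom.intro residue_field_hom_axioms.intro)
  show "ring_hom_cring R (R Quot M) ((+>) M)" by (rule rcos_ring_hom_cring[OF is_cring])
  show "field (R Quot M)" by (rule quotient_is_field[OF is_cring])
  show "ideal M R" by (rule is_ideal)
  show "M +> x = \<zero>\<^bsub>R Quot M\<^esub> \<longleftrightarrow> x \<in> M" if "x \<in> carrier R" for x
    using rcos_const_imp_mem[OF that] a_rcos_const[of x] by (auto simp: FactRing_def)
  show "carrier (R Quot M) \<subseteq> (+>) M ` carrier R"
    by (auto simp: FactRing_def A_RCOSETS_def')
qed

text \<open>An additive map with trivial kernel is injective. Expanding a = (a - b) + b avoids
  computing the q-th power of -b.\<close>

lemma inj_on_pow_of_reduced:
  fixes R (structure) and q :: nat
  assumes "cring R" and red: "reduced_ring R"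
    and add: "\<forall>a \<in> carrier R. \<forall>b \<in> carrier R.
      (a \<oplus> b) [^] q = a [^] q \<oplus> b [^] q"
  shows "inj_on (\<lambda>a. a [^] q) (carrier R)"
proof (rule inj_onI)
  interpret cring R by fact
  fix a b assume ab: "a \<in> carrier R" "b \<in> carrier R" and eq: "a [^] q = b [^] q"
  have "a = (a \<ominus> b) \<oplus> b" using ab by (simp add: minus_eq a_assoc l_neg)
  then have "a [^] q = (a \<ominus> b) [^] q \<oplus> b [^] q" using add ab by (metis minus_closed)
  then have "(a \<ominus> b) [^] q = \<zero>" using ab eq by simp
  then have "a \<ominus> b = \<zero>" using red ab unfolding reduced_ring_def by blast
  then show "a = b" using ab \<open>a = (a \<ominus> b) \<oplus> b\<close> by (metis l_zero)
qed

theorem theorem3p1: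
  fixes R :: "('a, 'b) ring_scheme" (structure)
    and M :: "'a set" and K :: "'a set ring" and n m :: nat
  assumes "local_ring M R"
    and "K = R Quot M"
    and "0 < n"
    and "m = free_part (ring_char K) n"
    and "\<not> ring_char K dvd n \<or> (ring_char R = ring_char K \<and> reduced_ring R)"
  shows "(nlevel R n \<ge> nlevel K m \<and> waring R n \<ge> waring K m) \<and>
    (henselian M R \<and> nlevel K m < \<infinity> \<longrightarrow>
       nlevel R n = nlevel K m \<and>
       waring R n \<le> max (waring K m) (nlevel K m + 1)) \<and>
    (M \<noteq> M \<cdot> M \<and> 1 < m \<longrightarrow>
       (\<forall>f \<in> M - M \<cdot> M. nlength R n f \<ge> nlevel K m + 1) \<and>
       (nlevel K m < \<infinity> \<longrightarrow> waring R n \<ge> nlevel K m + 1))"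
proof -
  interpret residue_field_hom R K "(+>) M" M
    unfolding \<open>K = R Quot M\<close> by (rule local_ring.residue_field_hom_quot) fact
  let ?p = "ring_char K"
  \<comment> \<open>Both alternatives of the hypothesis are merged into one factor \<open>q\<close>:
    it is 1 if the characteristic of \<open>K\<close> does not divide \<open>n\<close> (which
    includes characteristic 0), and otherwise the full power of that prime in
    \<open>n\<close>.\<close>
  obtain q where n: "n = q * m" and q: "0 < q" and pm: "\<not> ?p dvd m"
    and add: "\<forall>a \<in> carrier R. \<forall>b \<in> carrier R.
      (a \<oplus> b) [^] q = a [^] q \<oplus> b [^] q"
    and inj: "inj_on (\<lambda>a. a [^] q) (carrier R)"
  proof (cases "?p dvd n")
    case False
    then have "m = n"
      using assms(4) by (simp add: free_part_def not_dvd_imp_multiplicity_0)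
    then show thesis using that[of 1] False by (auto simp: inj_on_def)
  next
    case True
    have p0: "0 < ?p" using True \<open>0 < n\<close> by (cases "?p = 0") auto
    have p: "prime ?p" by (rule S.prime_ring_char[OF p0])
    have red: "reduced_ring R" and char: "ring_char R = ?p" using True assms(5) by auto
    let ?j = "multiplicity ?p n"
    have m: "m = n div ?p ^ ?j" using assms(4) p0 by (simp add: free_part_def)
    have "[?p] \<cdot> \<one> = \<zero>" using R.ring_char_dvd_iff[of ?p] char by simp
    then have add: "\<forall>a \<in> carrier R. \<forall>b \<in> carrier R.
        (a \<oplus> b) [^] (?p ^ ?j) = a [^] (?p ^ ?j) \<oplus> b [^] (?p ^ ?j)"
      using R.frobenius_pow_add[OF p] by blast
    show thesis
    proof (rule that[of "?p ^ ?j"])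
      show "n = ?p ^ ?j * m" unfolding m by (simp add: multiplicity_dvd)
      show "\<not> ?p dvd m"
        unfolding m using \<open>0 < n\<close> p by (intro multiplicity_decompose) auto
      show "inj_on (\<lambda>a. a [^] (?p ^ ?j)) (carrier R)"
        by (rule inj_on_pow_of_reduced[OF R.is_cring red add])
    qed (use p0 add in auto)
  qed
  have m: "[m] \<cdot>\<^bsub>K\<^esub> \<one>\<^bsub>K\<^esub> \<noteq> \<zero>\<^bsub>K\<^esub>" using pm S.ring_char_dvd_iff by simp
  \<comment> \<open>The Waring bounds are all proved for exponent \<open>m\<close>. For (c) this
    matters: if \<open>q > 1\<close>, a sum of n-th powers lying in \<open>M\<close> is a q-th power
    of an element of \<open>M\<close>, hence already in the square of \<open>M\<close>.\<close>
  have w: "waring R n = waring R m" unfolding n by (rule R.waring_mult[OF add inj q])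
  show ?thesis
  proof (intro conjI impI ballI)
    show "nlevel K m \<le> nlevel R n" unfolding n by (rule nlevel_mono)
    show "waring K m \<le> waring R n" unfolding w by (rule waring_mono)
  next
    assume b: "henselian M R \<and> nlevel K m < \<infinity>"
    show "nlevel R n = nlevel K m"
      unfolding n using b by (intro nlevel_eq m add q) auto
    show "waring R n \<le> max (waring K m) (nlevel K m + 1)"
      unfolding w using b by (intro waring_le_max m) auto
  next
    fix f assume "M \<noteq> M \<cdot> M \<and> 1 < m" "f \<in> M - M \<cdot> M"
    then show "nlevel K m + 1 \<le> nlength R n f"
      unfolding n by (intro nlength_ge q) auto
  next
    assume "M \<noteq> M \<cdot> M \<and> 1 < m" "nlevel K m < \<infinity>"
    then show "nlevel K m + 1 \<le> waring R n"
      unfolding w by (intro waring_ge m) auto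
  qed
qed

end
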